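(* Let $\Omega$ be a locally compact Hausdorff space, $\sigma$ a Radon measure on $\Omega$, and $G:\Omega\times\Omega\to[0,+\infty]$ a lower semicontinuous function which satisfies in $\Omega$ the weak maximum principle with constant $\mathfrak{b}\ge 1$. Let $g$ be a monotone non-decreasing positive continuous function on $[1,+\infty]$, and set $$F(t)=\int_1^t\frac{ds}{g(s)},\qquad t\ge 1 .$$ Let $u$ be a positive measurable function on $\Omega$ that satisfies $$u(x)\ \ge\ G(g(u)\,d\sigma)(x)+1 \qquad ( * )$$ for $\sigma$-almost all $x\in\Omega$. Then at any point $x\in\Omega$ where $( * )$ is satisfied and $u(x)<+\infty$, we have $$G\sigma(x)<\mathfrak{b}\,F(\infty)=\mathfrak{b}\int_1^{+\infty}\frac{ds}{g(s)}$$ and $$u(x)\ \ge\ 1+\mathfrak{b}\left[F^{-1}\big(\mathfrak{b}^{-1}G\sigma(x)\big)-1\right].$$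
   Context: For a measure $\nu$ on $\Omega$ write $G\nu(x)=\int_\Omega G(x,y)\,d\nu(y)$; for a measurable $f\ge 0$ write $G(f\,d\sigma)(x)=\int_\Omega G(x,y)f(y)\,d\sigma(y)$. Weak maximum principle with constant $\mathfrak{b}\ge1$: for any Radon measure $\nu$ in $\Omega$ with compact support $K=\mathrm{supp}(\nu)$, if $G\nu\le 1$ in $K$, then $G\nu\le\mathfrak{b}$ in $\Omega$. The function $u$ may take the value $+\infty$. The function $g$ is finite on $[1,+\infty)$ and $g(+\infty)=\lim_{t\to+\infty}g(t)\in(0,+\infty]$. The inequality $( * )$ forces $u\ge1$ where it holds, so $g(u)$ is defined $\sigma$-almost everywhere, which is all that is needed in $( * )$. $F(\infty)=\lim_{t\to+\infty}F(t)\in(0,+\infty]$, and $F^{-1}:[0,F(\infty))\to[1,+\infty)$ is the inverse function of $F:[1,+\infty)\to[0,F(\infty))$. *)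

theory Defs
  imports "HOL-Analysis.Analysis"
begin

definition lsc :: "('a::topological_space \<Rightarrow> ennreal) \<Rightarrow> bool" where
  "lsc f \<longleftrightarrow> (\<forall>c. open {x. c < f x})"

(* Borel measure that is finite on compact sets, outer regular on Borel sets and
   inner regular on open sets. *)
definition radon_measure :: "'a::t2_space measure \<Rightarrow> bool" where
  "radon_measure \<nu> \<longleftrightarrow>
     sets \<nu> = sets borel \<and>
     (\<forall>K. compact K \<longrightarrow> emeasure \<nu> K < \<infinity>) \<and>
     (\<forall>A\<in>sets borel. emeasure \<nu> A = (INF U\<in>{U. open U \<and> A \<subseteq> U}. emeasure \<nu> U)) \<and>
     (\<forall>U. open U \<longrightarrow> emeasure \<nu> U = (SUP K\<in>{K. compact K \<and> K \<subseteq> U}. emeasure \<nu> K))"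

definition measure_support :: "'a::topological_space measure \<Rightarrow> 'a set" where
  "measure_support \<nu> = {x. \<forall>U. open U \<and> x \<in> U \<longrightarrow> 0 < emeasure \<nu> U}"

definition potential :: "('a \<times> 'a \<Rightarrow> ennreal) \<Rightarrow> 'a measure \<Rightarrow> 'a \<Rightarrow> ennreal" where
  "potential G \<nu> x = (\<integral>\<^sup>+ y. G (x, y) \<partial>\<nu>)"

(* G(f d\<sigma>) *)
definition weighted_potential ::
    "('a \<times> 'a \<Rightarrow> ennreal) \<Rightarrow> ('a \<Rightarrow> ennreal) \<Rightarrow> 'a measure \<Rightarrow> 'a \<Rightarrow> ennreal" where
  "weighted_potential G f \<sigma> x = (\<integral>\<^sup>+ y. G (x, y) * f y \<partial>\<sigma>)"

definition weak_maximum_principle ::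
    "('a::t2_space \<times> 'a \<Rightarrow> ennreal) \<Rightarrow> real \<Rightarrow> bool" where
  "weak_maximum_principle G b \<longleftrightarrow>
     (\<forall>\<nu>. radon_measure \<nu> \<and> compact (measure_support \<nu>) \<and>
          (\<forall>x\<in>measure_support \<nu>. potential G \<nu> x \<le> 1)
          \<longrightarrow> (\<forall>x. potential G \<nu> x \<le> ennreal b))"

(* A function g on [1, +\<infinity>] is a function on ennreal of which only the values on {1..} matter;
   in the order topology of ennreal, continuity at \<infinity> says that g(\<infinity>) is the limit of g(t)
   as t tends to +\<infinity>, possibly +\<infinity> itself. *)
definition admissible_nonlinearity :: "(ennreal \<Rightarrow> ennreal) \<Rightarrow> bool" where
  "admissible_nonlinearity g \<longleftrightarrow>
     mono_on {1..} g \<and> continuous_on {1..} g \<and>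
     (\<forall>t\<ge>1. 0 < g t) \<and> (\<forall>t\<ge>1. t < \<infinity> \<longrightarrow> g t < \<infinity>)"

(* Meaningful for t \<ge> 1. *)
definition F :: "(ennreal \<Rightarrow> ennreal) \<Rightarrow> real \<Rightarrow> real" where
  "F g t = integral {1..t} (\<lambda>s. 1 / enn2real (g (ennreal s)))"

definition F_at_infinity :: "(ennreal \<Rightarrow> ennreal) \<Rightarrow> ennreal" where
  "F_at_infinity g = Lim at_top (\<lambda>t. ennreal (F g t))"

(* Inverse of F : [1, +\<infinity>) \<rightarrow> [0, F(\<infinity>)); meaningful for arguments in [0, F(\<infinity>)). *)
definition F_inverse :: "(ennreal \<Rightarrow> ennreal) \<Rightarrow> real \<Rightarrow> real" where
  "F_inverse g = inv_into {1..} (F g)"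

end

theory Submission
  imports Defs
begin

text \<open>Let \<open>K\<close> be compact with \<open>g(u)\<close> bounded on \<open>K\<close>, and put \<open>\<mu> = 1\<^sub>K g(u) \<sigma>\<close>, \<open>V = G\<mu>\<close>, so that
  \<open>1 + V \<le> u\<close> almost everywhere. As \<open>V\<close> is lower semicontinuous, \<open>K \<inter> {V \<le> t}\<close> is compact, and the
  weak maximum principle applied to \<open>\<mu>\<close> restricted to this set and divided by \<open>t\<close> shows that the
  measure \<open>\<rho> = G(x, \<cdot>) \<mu>\<close> satisfies \<open>\<rho>{V \<le> t} \<le> b t\<close>. Its total mass is \<open>V(x)\<close>, hence \<open>V\<close> has, under \<open>\<rho>\<close>,
  at most the distribution function of \<open>b\<close> times Lebesgue measure on \<open>[0, V(x)/b]\<close>. Since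
  \<open>1/g(1 + \<cdot>)\<close> is decreasing,
  \<open>\<integral>\<^sub>K G(x, y) d\<sigma>(y) \<le> \<integral> 1/g(1 + V) d\<rho> \<le> b \<integral>\<^sub>0 dt/g(1 + t) = b F(1 + V(x)/b)\<close>, the last integral
  extending up to \<open>V(x)/b\<close>. As \<open>V(x) \<le> u(x) - 1\<close>, exhausting by compact sets gives
  \<open>G\<sigma>(x) \<le> b F(1 + (u(x) - 1)/b)\<close>, which is both claims at once. Since only
  \<open>\<sigma>\<close>-finite Borel sets are inner regular, the exhaustion uses that
  \<open>G(x, \<cdot>) \<sigma>\<close> is a finite measure because \<open>g(u) \<ge> g(1) > 0\<close>.\<close>

section \<open>Exhaustion by increasing sets and regularity of Radon measures\<close>

text \<open>Monotone convergence. Points with \<open>h y = 0\<close> may stay uncovered: on the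
  zeros of a kernel \<open>G (x, \<cdot>)\<close> an exhaustion by sets of finite \<sigma>-measure
  does not exist in general.\<close>

lemma nn_integral_incseq_SUP:
  assumes D: "incseq D" "\<And>n. D n \<in> sets M" and h[measurable]: "h \<in> borel_measurable M"
    and cover: "AE y in M. h y \<noteq> 0 \<longrightarrow> y \<in> (\<Union>n. D n)"
  shows "(\<integral>\<^sup>+y. h y \<partial>M) = (SUP n. \<integral>\<^sup>+y. h y * indicator (D n) y \<partial>M)"
proof -
  note D(2)[measurable]
  have "(\<integral>\<^sup>+y. h y \<partial>M) = (\<integral>\<^sup>+y. (SUP n. h y * indicator (D n) y) \<partial>M)"
    using cover
  proof (intro nn_integral_cong_AE, eventually_elim)
    case (elim y)
    show ?case
    proof (cases "h y = 0")
      case False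
      then obtain n where "y \<in> D n" using elim by auto
      then show ?thesis
        by (intro antisym SUP_least SUP_upper2[of n]) (auto simp: indicator_def)
    qed simp
  qed
  also have "\<dots> = (SUP n. \<integral>\<^sup>+y. h y * indicator (D n) y \<partial>M)"
    using D(1) by (intro nn_integral_monotone_convergence_SUP)
      (auto simp: incseq_def le_fun_def indicator_def)
  finally show ?thesis .
qed

lemma radon_measureD:
  assumes "radon_measure \<nu>"
  shows radon_measure_sets: "sets \<nu> = sets borel"
    and radon_measure_compact: "compact K \<Longrightarrow> emeasure \<nu> K < \<infinity>"
    and radon_measure_outer: "A \<in> sets borel \<Longrightarrow>
      emeasure \<nu> A = (INF U\<in>{U. open U \<and> A \<subseteq> U}. emeasure \<nu> U)"
    and radon_measure_inner: "open U \<Longrightarrow>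
      emeasure \<nu> U = (SUP K\<in>{K. compact K \<and> K \<subseteq> U}. emeasure \<nu> K)"
proof -
  note c = assms[unfolded radon_measure_def]
  show "sets \<nu> = sets borel" by (rule conjunct1[OF c])
  show "compact K \<Longrightarrow> emeasure \<nu> K < \<infinity>"
    by (rule conjunct1[OF conjunct2[OF c], rule_format])
  show "A \<in> sets borel \<Longrightarrow> emeasure \<nu> A = (INF U\<in>{U. open U \<and> A \<subseteq> U}. emeasure \<nu> U)"
    by (rule conjunct1[OF conjunct2[OF conjunct2[OF c]], rule_format])
  show "open U \<Longrightarrow> emeasure \<nu> U = (SUP K\<in>{K. compact K \<and> K \<subseteq> U}. emeasure \<nu> K)"
    by (rule conjunct2[OF conjunct2[OF conjunct2[OF c]], rule_format])
qed

text \<open>Choose an open U \<supseteq> A of finite measure, a compact K filling U up to e, and an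
  open W \<supseteq> U - A exceeding it by at most e. Then K - W is a compact subset of A that
  misses at most 2e of its measure. Finiteness of \<open>emeasure \<nu> A\<close> turns outer
  regularity into a bound on a difference set.\<close>

lemma radon_measure_inner_regular:
  assumes \<nu>: "radon_measure \<nu>" and A: "A \<in> sets borel" and fin: "emeasure \<nu> A < \<infinity>"
  obtains L :: "nat \<Rightarrow> 'a::t2_space set"
  where "\<And>n. compact (L n)" "\<And>n. L n \<subseteq> A" "incseq L" "emeasure \<nu> (A - (\<Union>n. L n)) = 0"
proof -
  note sets = radon_measure_sets[OF \<nu>] and outer = radon_measure_outer[OF \<nu>]
    and inner = radon_measure_inner[OF \<nu>]
  have sb: "B \<in> sets \<nu>" if "B \<in> sets borel" for B using that sets by simp
  have outer_eps: "\<exists>U. open U \<and> B \<subseteq> U \<and> emeasure \<nu> (U - B) \<le> e \<and> emeasure \<nu> U < \<infinity>"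
    if B: "B \<in> sets borel" "emeasure \<nu> B < \<infinity>" and e: "0 < e" "e < \<infinity>" for B :: "'a set" and e :: ennreal
  proof -
    have "(INF U\<in>{U. open U \<and> B \<subseteq> U}. emeasure \<nu> U) < emeasure \<nu> B + e"
      using outer[OF B(1)] B(2) e by (metis ennreal_add_left_cancel_less add.right_neutral infinity_ennreal_def)
    then obtain U where U: "open U" "B \<subseteq> U" "emeasure \<nu> U < emeasure \<nu> B + e"
      by (auto simp: INF_less_iff)
    have eq: "emeasure \<nu> (U - B) = emeasure \<nu> U - emeasure \<nu> B"
      using U B by (intro emeasure_Diff) (auto intro!: sb)
    have "emeasure \<nu> (U - B) \<le> e"
      unfolding eq using U(3) B(2) by (auto simp: ennreal_minus_le_iff less_imp_le)
    moreover have "emeasure \<nu> U < \<infinity>" using U(3) B(2) e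
      by (metis ennreal_add_less_top infinity_ennreal_def order_less_trans)
    ultimately show ?thesis using U by blast
  qed
  have inner_eps: "\<exists>K. compact K \<and> K \<subseteq> A \<and> emeasure \<nu> (A - K) \<le> e + e"
    if e: "0 < e" "e < \<infinity>" for e :: ennreal
  proof -
    obtain U where U: "open U" "A \<subseteq> U" "emeasure \<nu> U < \<infinity>"
      using outer_eps[OF A fin e] by blast
    have UA: "U - A \<in> sets borel" "emeasure \<nu> (U - A) < \<infinity>"
      using U A sets le_less_trans[OF emeasure_mono[of "U - A" U \<nu>] U(3)] by auto
    obtain W where W: "open W" "U - A \<subseteq> W" "emeasure \<nu> (W - (U - A)) \<le> e"
      using outer_eps[OF UA e] by blast
    \<comment> \<open>If U is null, \<open>emeasure \<nu> U - e < emeasure \<nu> U\<close> fails and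
      the empty set serves as K.\<close>
    obtain K where K: "compact K" "K \<subseteq> U" "emeasure \<nu> U \<le> emeasure \<nu> K + e"
    proof (cases "emeasure \<nu> U = 0")
      case True then show ?thesis using that[of "{}"] by simp
    next
      case False
      have "emeasure \<nu> U - e < emeasure \<nu> U"
        using False U(3) e by (intro ennreal_between) (auto simp: zero_less_iff_neq_zero)
      then obtain K where "compact K" "K \<subseteq> U" "emeasure \<nu> U - e < emeasure \<nu> K"
        unfolding inner[OF U(1)] by (auto simp: less_SUP_iff)
      moreover from this have "emeasure \<nu> U \<le> emeasure \<nu> K + e"
        by (metis ennreal_minus_le_iff add.commute less_imp_le)
      ultimately show ?thesis using that by blast
    qed
    have Ks: "K \<in> sets borel" using K by (simp add: compact_imp_closed)
    have Kfin: "emeasure \<nu> K < \<infinity>" using emeasure_mono[OF K(2)] U(3) U(1) sets by (metis borel_open le_less_trans)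
    have "emeasure \<nu> (U - K) = emeasure \<nu> U - emeasure \<nu> K"
      using U K Ks Kfin by (intro emeasure_Diff) (auto intro!: sb)
    also have "\<dots> \<le> e" using K(3) Kfin by (auto simp: ennreal_minus_le_iff)
    finally have UK: "emeasure \<nu> (U - K) \<le> e" .
    \<comment> \<open>A point of A outside K - W either lies in W, hence in W - (U - A), or lies
      outside K, hence in U - K.\<close>
    have "A - (K - W) \<subseteq> (W - (U - A)) \<union> (U - K)" using U by auto
    then have "emeasure \<nu> (A - (K - W)) \<le> emeasure \<nu> ((W - (U - A)) \<union> (U - K))"
      using U K W A Ks sets by (intro emeasure_mono) auto
    also have "\<dots> \<le> emeasure \<nu> (W - (U - A)) + emeasure \<nu> (U - K)"
      using U K W A Ks sets by (intro emeasure_subadditive) auto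
    also have "\<dots> \<le> e + e" using W UK by (intro add_mono)
    finally have "emeasure \<nu> (A - (K - W)) \<le> e + e" .
    moreover have "K - W \<subseteq> A" "compact (K - W)" using K W by (auto intro: compact_diff)
    ultimately show ?thesis by blast
  qed
  define e where "e n = ennreal (1 / Suc n)" for n
  have "\<exists>K. compact K \<and> K \<subseteq> A \<and> emeasure \<nu> (A - K) \<le> e n + e n" for n
    by (rule inner_eps) (auto simp: e_def)
  then obtain K where K: "\<And>n. compact (K n)" "\<And>n. K n \<subseteq> A" "\<And>n. emeasure \<nu> (A - K n) \<le> e n + e n"
    by metis
  define L where "L n = (\<Union>i\<le>n. K i)" for n
  have Kb: "K n \<in> sets borel" for n using K by (simp add: compact_imp_closed)
  show ?thesis
  proof (rule that)
    show "compact (L n)" "L n \<subseteq> A" for n using K by (auto simp: L_def)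
    show "incseq L" unfolding L_def by (intro monoI UN_mono) auto
    have le: "emeasure \<nu> (A - (\<Union>n. L n)) \<le> e n + e n" for n
      by (rule order_trans[OF emeasure_mono K(3)]) (use A Kb sets in \<open>auto simp: L_def\<close>)
    have "(\<lambda>n. e n + e n) \<longlonglongrightarrow> ennreal 0 + ennreal 0"
      unfolding e_def by (intro tendsto_add tendsto_ennrealI LIMSEQ_Suc lim_1_over_n)
    then have "emeasure \<nu> (A - (\<Union>n. L n)) \<le> 0 + 0"
      using le by (intro LIMSEQ_le_const) auto
    then show "emeasure \<nu> (A - (\<Union>n. L n)) = 0" by simp
  qed
qed

text \<open>Approximation of every Borel set from inside by compact sets, up to a null set, gives
  outer regularity by passing to complements; the finite total mass permits the subtraction.\<close>

lemma finite_measure_radonI: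
  fixes \<mu> :: "'a::t2_space measure"
  assumes sets: "sets \<mu> = sets borel" and fin: "emeasure \<mu> UNIV < \<infinity>"
    and inner: "\<And>A. A \<in> sets borel \<Longrightarrow> \<exists>L. (\<forall>n. compact (L n)) \<and> (\<forall>n. L n \<subseteq> A) \<and> incseq L \<and>
      emeasure \<mu> (A - (\<Union>n::nat. L n)) = 0"
  shows "radon_measure \<mu>"
proof -
  have fin': "emeasure \<mu> A < \<infinity>" if "A \<in> sets borel" for A
    using emeasure_mono[of A UNIV \<mu>] fin sets by (simp add: order_le_less_trans)
  have sp: "space \<mu> = UNIV" using sets_eq_imp_space_eq[OF sets] by simp
  have inner_sup: "\<exists>L. (\<forall>n. compact (L n)) \<and> (\<forall>n. L n \<subseteq> A) \<and> (\<lambda>n::nat. emeasure \<mu> (L n)) \<longlonglongrightarrow> emeasure \<mu> A"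
    if A: "A \<in> sets borel" for A
  proof -
    obtain L where L: "\<And>n. compact (L n)" "\<And>n::nat. L n \<subseteq> A" "incseq L" "emeasure \<mu> (A - (\<Union>n. L n)) = 0"
      using inner[OF A] by blast
    have Lb: "L n \<in> sets borel" for n using L by (simp add: compact_imp_closed)
    have "emeasure \<mu> A = emeasure \<mu> ((\<Union>n. L n) \<union> (A - (\<Union>n. L n)))"
      using L(2) by (intro arg_cong[of _ _ "emeasure \<mu>"]) auto
    also have "\<dots> = emeasure \<mu> (\<Union>n. L n)"
      using L(4) A Lb sets by (intro emeasure_Un_null_set) (auto simp: null_sets_def)
    finally have "emeasure \<mu> A = emeasure \<mu> (\<Union>n. L n)" .
    moreover have "(\<lambda>n. emeasure \<mu> (L n)) \<longlonglongrightarrow> emeasure \<mu> (\<Union>n. L n)"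
      using L(3) Lb sets by (intro Lim_emeasure_incseq) auto
    ultimately show ?thesis using L by auto
  qed
  show ?thesis
    unfolding radon_measure_def
  proof (intro conjI allI impI ballI)
    fix K :: "'a set" assume "compact K"
    then show "emeasure \<mu> K < \<infinity>" by (intro fin') (simp add: compact_imp_closed)
  next
    fix A :: "'a set" assume A: "A \<in> sets borel"
    \<comment> \<open>The sets \<open>- L n\<close> are open, contain A, and their measures tend to
      that of A.\<close>
    obtain L where L: "\<And>n. compact (L n)" "\<And>n. L n \<subseteq> - A" "(\<lambda>n::nat. emeasure \<mu> (L n)) \<longlonglongrightarrow> emeasure \<mu> (- A)"
      using inner_sup[of "- A"] A by auto
    have compl: "emeasure \<mu> (- B) = emeasure \<mu> UNIV - emeasure \<mu> B" if "B \<in> sets borel" for B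
      using emeasure_compl[of B \<mu>] that fin'[OF that] sets sp by (simp add: Compl_eq_Diff_UNIV)
    have Lb: "L n \<in> sets borel" for n using L by (simp add: compact_imp_closed)
    have "(\<lambda>n. emeasure \<mu> UNIV - emeasure \<mu> (L n)) \<longlonglongrightarrow> emeasure \<mu> UNIV - emeasure \<mu> (- A)"
      using fin fin'[OF Lb] fin'[of "- A"] A by (intro tendsto_diff_ennreal L) auto
    then have lim: "(\<lambda>n. emeasure \<mu> (- L n)) \<longlonglongrightarrow> emeasure \<mu> A"
      using compl[of "- A"] compl[OF Lb] A by simp
    show "emeasure \<mu> A = (INF U\<in>{U. open U \<and> A \<subseteq> U}. emeasure \<mu> U)"
    proof (rule antisym)
      show "emeasure \<mu> A \<le> (INF U\<in>{U. open U \<and> A \<subseteq> U}. emeasure \<mu> U)"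
        using sets by (auto intro!: INF_greatest emeasure_mono)
      show "(INF U\<in>{U. open U \<and> A \<subseteq> U}. emeasure \<mu> U) \<le> emeasure \<mu> A"
        using L by (intro LIMSEQ_le_const[OF lim] exI[of _ 0] allI impI INF_lower)
          (auto simp: open_Compl compact_imp_closed)
    qed
  next
    fix U :: "'a set" assume U: "open U"
    obtain L where L: "\<And>n. compact (L n)" "\<And>n. L n \<subseteq> U" "(\<lambda>n::nat. emeasure \<mu> (L n)) \<longlonglongrightarrow> emeasure \<mu> U"
      using inner_sup[of U] U by auto
    show "emeasure \<mu> U = (SUP K\<in>{K. compact K \<and> K \<subseteq> U}. emeasure \<mu> K)"
    proof (rule antisym)
      show "emeasure \<mu> U \<le> (SUP K\<in>{K. compact K \<and> K \<subseteq> U}. emeasure \<mu> K)"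
        using L by (intro LIMSEQ_le_const2[OF L(3)] exI[of _ 0] allI impI SUP_upper) auto
      show "(SUP K\<in>{K. compact K \<and> K \<subseteq> U}. emeasure \<mu> K) \<le> emeasure \<mu> U"
        using U sets by (auto intro!: SUP_least emeasure_mono)
    qed
  qed (fact sets)
qed

text \<open>The total mass is at most \<open>ennreal c\<close> times that of K. Inner regularity is
  inherited from \<sigma>, since \<sigma>-null sets are null for the density and nothing is charged
  off K.\<close>

lemma radon_measure_density:
  fixes \<sigma> :: "'a::t2_space measure"
  assumes \<sigma>: "radon_measure \<sigma>" and k: "k \<in> borel_measurable borel" and K: "compact K"
    and bound: "\<And>y. k y \<le> ennreal c * indicator K y"
  shows "radon_measure (density \<sigma> k)" "emeasure (density \<sigma> k) UNIV < \<infinity>"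
proof -
  note sets = radon_measure_sets[OF \<sigma>] and Kfin = radon_measure_compact[OF \<sigma> K]
  have k'[measurable]: "k \<in> borel_measurable \<sigma>" using k measurable_cong_sets[OF sets refl] by blast
  have Kb: "K \<in> sets borel" using K by (simp add: compact_imp_closed)
  have "emeasure (density \<sigma> k) UNIV = (\<integral>\<^sup>+y. k y \<partial>\<sigma>)"
    using sets by (subst emeasure_density) auto
  also have "\<dots> \<le> (\<integral>\<^sup>+y. ennreal c * indicator K y \<partial>\<sigma>)" by (intro nn_integral_mono bound)
  also have "\<dots> = ennreal c * emeasure \<sigma> K" using Kb sets by (simp add: nn_integral_cmult_indicator)
  also have "\<dots> < \<infinity>" using Kfin by (simp add: ennreal_mult_less_top)
  finally show fin: "emeasure (density \<sigma> k) UNIV < \<infinity>" .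
  show "radon_measure (density \<sigma> k)"
  proof (rule finite_measure_radonI)
    fix A :: "'a set" assume A: "A \<in> sets borel"
    \<comment> \<open>A itself may have infinite \<sigma>-measure, so the compact sets are chosen
      inside \<open>A \<inter> K\<close>.\<close>
    have "emeasure \<sigma> (A \<inter> K) < \<infinity>"
      using emeasure_mono[of "A \<inter> K" K \<sigma>] Kfin Kb sets by (simp add: order_le_less_trans)
    then obtain L where L: "\<And>n. compact (L n)" "\<And>n::nat. L n \<subseteq> A \<inter> K" "incseq L"
        "emeasure \<sigma> (A \<inter> K - (\<Union>n. L n)) = 0"
      using radon_measure_inner_regular[OF \<sigma>, of "A \<inter> K"] A Kb by auto
    have Lb: "L n \<in> sets borel" for n using L by (simp add: compact_imp_closed)
    have "(\<Union>n. L n) \<in> sets borel" using Lb by auto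
    then have null: "A \<inter> K - (\<Union>n. L n) \<in> null_sets \<sigma>" using L(4) A Kb sets by (auto simp: null_sets_def)
    have "emeasure (density \<sigma> k) (A - (\<Union>n. L n)) = (\<integral>\<^sup>+y. k y * indicator (A - (\<Union>n. L n)) y \<partial>\<sigma>)"
      using A Lb sets by (intro emeasure_density) auto
    also have "\<dots> = (\<integral>\<^sup>+y. 0 \<partial>\<sigma>)"
    proof (rule nn_integral_cong_AE)
      show "AE y in \<sigma>. k y * indicator (A - (\<Union>n. L n)) y = 0"
        using AE_not_in[OF null]
      proof eventually_elim
        case (elim y)
        then show ?case using bound[of y] by (auto simp: indicator_def split: if_splits)
      qed
    qed
    finally have "emeasure (density \<sigma> k) (A - (\<Union>n. L n)) = 0" by simp
    then show "\<exists>L. (\<forall>n. compact (L n)) \<and> (\<forall>n. L n \<subseteq> A) \<and> incseq L \<and>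
      emeasure (density \<sigma> k) (A - (\<Union>n::nat. L n)) = 0"
      using L by (intro exI[of _ L]) auto
  qed (use sets fin in auto)
qed

section \<open>Lower semicontinuous kernels and their potentials\<close>

lemma borel_measurable_lsc: "lsc f \<Longrightarrow> f \<in> borel_measurable borel"
  unfolding lsc_def by (intro borel_measurableI_greater) simp

lemma lsc_section:
  fixes G :: "'a::topological_space \<times> 'a \<Rightarrow> ennreal"
  assumes "lsc G"
  shows "lsc (\<lambda>y. G (x, y))"
  unfolding lsc_def
proof
  fix c
  have "open (Pair x -` {p. c < G p})"
    using assms unfolding lsc_def by (intro open_vimage) (auto intro!: continuous_intros)
  then show "open {y. c < G (x, y)}" by (simp add: vimage_def)
qed

text \<open>Slack for the proof of \<open>lsc_potential\<close>: lower semicontinuity gives open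
  sets from strict inequalities only, and a bound \<open>s \<le> G (z, \<cdot>)\<close> becomes
  strict after multiplication by \<theta> < 1 wherever s is positive and finite.\<close>

lemma ennreal_less_scaled:
  fixes c a :: ennreal
  assumes "c < a"
  obtains \<theta> :: real where "0 < \<theta>" "\<theta> < 1" "c < ennreal \<theta> * a"
proof (cases a)
  case top
  then show ?thesis using assms that[of "1/2"] by (simp add: ennreal_mult_top)
next
  case (real r)
  with assms obtain s where s: "c = ennreal s" "0 \<le> s" by (cases c) auto
  have "s < r" using assms real s by (simp add: ennreal_less_iff)
  \<comment> \<open>This \<theta> makes \<open>\<theta> * a\<close> the midpoint of c and a.\<close>
  then show ?thesis using real s that[of "(s + r) / (2 * r)"]
    by (auto simp: ennreal_mult[symmetric] ennreal_less_iff field_simps)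
qed

text \<open>In a space without countable neighbourhood bases Fatou's lemma would give only
  sequential semicontinuity. Instead, G(z, \<cdot>) is bounded below by a simple function, whose
  level sets are replaced by compact subsets. The tube lemma on each of these finitely many sets
  keeps the slightly shrunk bound valid for all points near z.\<close>

lemma lsc_potential:
  fixes \<mu> :: "'a::t2_space measure"
  assumes \<mu>: "radon_measure \<mu>" and fin: "emeasure \<mu> UNIV < \<infinity>" and G: "lsc G"
  shows "lsc (potential G \<mu>)"
  unfolding lsc_def
proof
  fix c
  have sets: "sets \<mu> = sets borel" by (rule radon_measure_sets[OF \<mu>])
  have sp: "space \<mu> = UNIV" using sets_eq_imp_space_eq[OF sets] by simp
  show "open {z. c < potential G \<mu> z}"
  proof (subst open_subopen, intro ballI)
    fix z assume "z \<in> {z. c < potential G \<mu> z}"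
    then obtain \<theta> where \<theta>: "0 < \<theta>" "\<theta> < 1" and "c < ennreal \<theta> * potential G \<mu> z"
      using ennreal_less_scaled by blast
    then obtain s where s: "simple_function \<mu> s" "s \<le> (\<lambda>y. G (z, y))" "\<And>y. s y < top"
      and c: "c < ennreal \<theta> * integral\<^sup>S \<mu> s"
      unfolding potential_def nn_integral_def_finite
      by (auto simp: SUP_mult_left_ennreal less_SUP_iff)
    define R where "R = range s"
    have R: "finite R" using simple_functionD(1)[OF s(1)] sp by (simp add: R_def)
    have s_meas[measurable]: "s \<in> borel_measurable \<mu>" using s(1) by (rule borel_measurable_simple_function)
    have sb: "s -` {q} \<in> sets borel" for q
      using simple_functionD(2)[OF s(1), of "{q}"] sp sets by simp
    have "\<exists>L. (\<forall>n. compact (L n)) \<and> (\<forall>n::nat. L n \<subseteq> s -` {q}) \<and> incseq L \<and>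
        emeasure \<mu> (s -` {q} - (\<Union>n. L n)) = 0" for q
    proof -
      have "emeasure \<mu> (s -` {q}) < \<infinity>"
        using emeasure_mono[of "s -` {q}" UNIV \<mu>] fin sets by (simp add: order_le_less_trans)
      from radon_measure_inner_regular[OF \<mu> sb this] show ?thesis by metis
    qed
    then obtain L where L: "\<And>q n. compact (L q n)" "\<And>q n. L q n \<subseteq> s -` {q}"
        "\<And>q. incseq (L q)" "\<And>q. emeasure \<mu> (s -` {q} - (\<Union>n::nat. L q n)) = 0"
      by metis
    have Lb: "L q n \<in> sets borel" for q n using L by (simp add: compact_imp_closed)
    have null: "s -` {q} - (\<Union>n. L q n) \<in> null_sets \<mu>" for q
    proof -
      have "(\<Union>n. L q n) \<in> sets borel" using Lb by auto
      then show ?thesis using L(4) sb sets by (auto simp: null_sets_def)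
    qed
    define K where "K n = (\<Union>q\<in>R. L q n)" for n
    have Kb[measurable]: "K n \<in> sets \<mu>" for n using Lb R sets by (auto simp: K_def)
    have K_mono: "K n \<subseteq> K (Suc n)" for n
      unfolding K_def using incseq_SucD[OF L(3)] by (intro UN_mono) auto
    have "AE y in \<mu>. \<forall>q\<in>R. y \<notin> s -` {q} - (\<Union>n. L q n)"
      using R by (rule AE_finite_allI) (rule AE_not_in[OF null])
    then have AE_K: "AE y in \<mu>. y \<in> (\<Union>n. K n)"
    proof eventually_elim
      case (elim y)
      have "s y \<in> R" by (simp add: R_def)
      then show ?case using elim by (auto simp: K_def)
    qed
    have "ennreal \<theta> * integral\<^sup>S \<mu> s = (\<integral>\<^sup>+y. ennreal \<theta> * s y \<partial>\<mu>)"
      using nn_integral_eq_simple_integral[OF s(1)] by (simp add: nn_integral_cmult)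
    \<comment> \<open>The strict bound c survives for a single n, which leaves one compact set for
      each of the finitely many values of s.\<close>
    also have "\<dots> = (SUP n. \<integral>\<^sup>+y. ennreal \<theta> * s y * indicator (K n) y \<partial>\<mu>)"
      using AE_K K_mono by (intro nn_integral_incseq_SUP incseq_SucI) auto
    finally obtain n where n: "c < (\<integral>\<^sup>+y. ennreal \<theta> * s y * indicator (K n) y \<partial>\<mu>)"
      using c by (auto simp: less_SUP_iff)
    \<comment> \<open>The value 0 is left out because \<open>\<theta> * 0 < 0\<close> is false;
      where s vanishes the final estimate is trivial. For the other values, finiteness of s makes
      \<open>\<theta> * q < q\<close> strict.\<close>
    have "\<exists>X. z \<in> X \<and> open X \<and> X \<times> L q n \<subseteq> {p. ennreal \<theta> * q < G p}" if "q \<in> R - {0}" for q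
    proof (rule Elementary_Topology.tube_lemma[OF L(1)])
      show "open {p. ennreal \<theta> * q < G p}" using G by (simp add: lsc_def)
      show "{z} \<times> L q n \<subseteq> {p. ennreal \<theta> * q < G p}"
      proof safe
        fix y assume y: "y \<in> L q n"
        then have q: "s y = q" using L(2) by auto
        have "ennreal \<theta> * q < 1 * q"
          using that \<theta> q s(3)[of y] by (intro ennreal_mult_strict_right_mono) (auto simp: ennreal_less_one_iff zero_less_iff_neq_zero)
        also have "\<dots> \<le> G (z, y)" using s(2) q by (auto simp: le_fun_def)
        finally show "ennreal \<theta> * q < G (z, y)" .
      qed
    qed
    then obtain X where X: "\<And>q. q \<in> R - {0} \<Longrightarrow> z \<in> X q \<and> open (X q) \<and> X q \<times> L q n \<subseteq> {p. ennreal \<theta> * q < G p}"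
      by metis
    define T where "T = (\<Inter>q\<in>R - {0}. X q)"
    have "open T" "z \<in> T" using X R by (auto simp: T_def)
    moreover have "c < potential G \<mu> z'" if z': "z' \<in> T" for z'
      unfolding potential_def
    proof (rule less_le_trans[OF n nn_integral_mono])
      fix y
      show "ennreal \<theta> * s y * indicator (K n) y \<le> G (z', y)"
      proof (cases "y \<in> K n \<and> s y \<noteq> 0")
        case True
        then obtain q where q: "q \<in> R" "y \<in> L q n" by (auto simp: K_def)
        then have "s y = q" using L(2) by auto
        then show ?thesis using True X[of q] q z' by (force simp: T_def intro: less_imp_le)
      qed auto
    qed
    ultimately show "\<exists>T. open T \<and> z \<in> T \<and> T \<subseteq> {z. c < potential G \<mu> z}" by blast
  qed
qed

section \<open>Distribution of a potential under the weak maximum principle\<close>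

text \<open>With V the potential of \<open>density \<sigma> k\<close>, let h be k/t cut off to the
  set where V \<le> t. The potential of \<open>density \<sigma> h\<close> is at most V/t everywhere,
  hence at most 1 on its support. The cut-off set is closed by semicontinuity of V, so the support
  stays inside it. The maximum principle yields the bound b at x, and multiplying by t gives the
  claim.\<close>

lemma potential_level_set_bound:
  fixes \<mu> :: "'a::t2_space measure"
  assumes \<sigma>: "radon_measure \<sigma>" and G: "lsc G" and wmp: "weak_maximum_principle G b" and b: "0 \<le> b"
    and k[measurable]: "k \<in> borel_measurable borel" and K: "compact K"
    and bound: "\<And>y. k y \<le> ennreal c * indicator K y" and t: "0 < t"
  shows "(\<integral>\<^sup>+y. G (x, y) * indicator {y. potential G (density \<sigma> k) y \<le> ennreal t} y \<partial>density \<sigma> k)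
    \<le> ennreal (b * t)"
proof -
  define V where "V = potential G (density \<sigma> k)"
  have sets[measurable_cong]: "sets \<sigma> = sets borel" by (rule radon_measure_sets[OF \<sigma>])
  have G_meas[measurable]: "(\<lambda>y. G (z, y)) \<in> borel_measurable borel" for z
    by (rule borel_measurable_lsc[OF lsc_section[OF G]])
  have V: "lsc V" unfolding V_def using radon_measure_density[OF \<sigma> k K bound] G by (intro lsc_potential)
  define A where "A = {y. V y \<le> ennreal t}"
  have "closed A" using V unfolding lsc_def A_def closed_def by (simp add: Compl_eq not_le)
  then have Ab[measurable]: "A \<in> sets borel" by simp
  define h where "h y = ennreal (1 / t) * (k y * indicator A y)" for y
  have h[measurable]: "h \<in> borel_measurable borel" unfolding h_def by measurable
  have hk: "h y = 0" if "y \<notin> K \<inter> A" for y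
    using that bound[of y] by (auto simp: h_def indicator_def split: if_splits)
  \<comment> \<open>A negative c means \<open>ennreal c = 0\<close>; \<open>max 0 c\<close> denotes
    the same bound and lets \<open>ennreal\<close> commute with the product.\<close>
  have hb: "h y \<le> ennreal (1 / t * max 0 c) * indicator K y" for y
  proof (cases "y \<in> K \<inter> A")
    case True
    have "k y \<le> ennreal (max 0 c)" using bound[of y] True by (auto simp: max_def ennreal_neg)
    then have "ennreal (1 / t) * k y \<le> ennreal (1 / t) * ennreal (max 0 c)" by (intro mult_left_mono) auto
    then show ?thesis using True t by (simp add: h_def ennreal_mult[symmetric])
  qed (simp add: hk)
  have rad: "radon_measure (density \<sigma> h)" by (rule radon_measure_density[OF \<sigma> h K hb])
  have pot: "potential G (density \<sigma> h) z =
      ennreal (1 / t) * (\<integral>\<^sup>+y. G (z, y) * indicator A y \<partial>density \<sigma> k)" for z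
  proof -
    have "potential G (density \<sigma> h) z = (\<integral>\<^sup>+y. h y * G (z, y) \<partial>\<sigma>)"
      unfolding potential_def by (intro nn_integral_density) auto
    also have "\<dots> = (\<integral>\<^sup>+y. ennreal (1 / t) * (k y * (G (z, y) * indicator A y)) \<partial>\<sigma>)"
      by (intro nn_integral_cong) (simp add: h_def ac_simps)
    also have "\<dots> = ennreal (1 / t) * (\<integral>\<^sup>+y. k y * (G (z, y) * indicator A y) \<partial>\<sigma>)"
      by (intro nn_integral_cmult) auto
    also have "(\<integral>\<^sup>+y. k y * (G (z, y) * indicator A y) \<partial>\<sigma>) = (\<integral>\<^sup>+y. G (z, y) * indicator A y \<partial>density \<sigma> k)"
      by (intro nn_integral_density[symmetric]) auto
    finally show ?thesis .
  qed
  have supp: "measure_support (density \<sigma> h) \<subseteq> K \<inter> A"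
  proof
    fix y assume y: "y \<in> measure_support (density \<sigma> h)"
    show "y \<in> K \<inter> A"
    proof (rule ccontr)
      assume "y \<notin> K \<inter> A"
      moreover have op: "open (- (K \<inter> A))"
        using K \<open>closed A\<close> by (simp only: open_Compl closed_Int compact_imp_closed)
      ultimately have "0 < emeasure (density \<sigma> h) (- (K \<inter> A))"
        using y unfolding measure_support_def by blast
      also have "emeasure (density \<sigma> h) (- (K \<inter> A)) = (\<integral>\<^sup>+y. h y * indicator (- (K \<inter> A)) y \<partial>\<sigma>)"
        using op sets by (intro emeasure_density) auto
      also have "\<dots> = (\<integral>\<^sup>+y. 0 \<partial>\<sigma>)"
        by (intro nn_integral_cong) (metis ComplD hk indicator_simps(2) mult_zero_left mult_zero_right)
      finally show False by simp
    qed
  qed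
  \<comment> \<open>A point off the support has an open null neighbourhood, and no point of that
    neighbourhood is in the support. Being closed in the compact K, the support is compact.\<close>
  have "closed (measure_support (density \<sigma> h))"
    unfolding closed_def
    by (subst open_subopen) (fastforce simp: measure_support_def subset_eq zero_less_iff_neq_zero)
  with K have "compact (K \<inter> measure_support (density \<sigma> h))" by (rule compact_Int_closed)
  then have "compact (measure_support (density \<sigma> h))" using supp by (simp add: Int_absorb1)
  moreover have "potential G (density \<sigma> h) z \<le> 1" if "z \<in> measure_support (density \<sigma> h)" for z
  proof -
    have "(\<integral>\<^sup>+y. G (z, y) * indicator A y \<partial>density \<sigma> k) \<le> (\<integral>\<^sup>+y. G (z, y) \<partial>density \<sigma> k)"
      by (rule nn_integral_mono) (simp add: indicator_def)
    then have "potential G (density \<sigma> h) z \<le> ennreal (1 / t) * V z"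
      unfolding pot V_def by (simp add: potential_def mult_left_mono)
    also have "\<dots> \<le> ennreal (1 / t) * ennreal t"
      using that supp by (intro mult_left_mono) (auto simp: A_def)
    also have "\<dots> = 1" using t by (simp add: ennreal_mult[symmetric])
    finally show ?thesis .
  qed
  ultimately have *: "potential G (density \<sigma> h) x \<le> ennreal b"
    using wmp rad unfolding weak_maximum_principle_def by blast
  have "(\<integral>\<^sup>+y. G (x, y) * indicator A y \<partial>density \<sigma> k) = ennreal t * potential G (density \<sigma> h) x"
    using t by (simp add: pot mult.assoc[symmetric] ennreal_mult[symmetric])
  also have "\<dots> \<le> ennreal t * ennreal b" by (intro mult_left_mono *) simp
  also have "\<dots> = ennreal (b * t)" using t b by (simp add: ennreal_mult[symmetric] mult.commute)
  finally show ?thesis by (simp add: A_def V_def)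
qed

section \<open>Comparison of integrals through distribution functions\<close>

text \<open>By the layer-cake formula each integral is the Lebesgue integral over s \<ge> 0 of the
  measure of a strict superlevel set, so the inequality can be checked for each s.
  \<sigma>-finiteness justifies the exchange of integrals.\<close>

lemma nn_integral_mono_distribution:
  assumes sf: "sigma_finite_measure M" "sigma_finite_measure N"
    and f[measurable]: "f \<in> borel_measurable M" and h[measurable]: "h \<in> borel_measurable N"
    and le: "\<And>s. 0 \<le> s \<Longrightarrow> emeasure M {y \<in> space M. ennreal s < f y} \<le> emeasure N {y \<in> space N. ennreal s < h y}"
  shows "(\<integral>\<^sup>+y. f y \<partial>M) \<le> (\<integral>\<^sup>+y. h y \<partial>N)"
proof -
  have layer: "(\<integral>\<^sup>+y. f y \<partial>M) =
      (\<integral>\<^sup>+s. emeasure M {y \<in> space M. ennreal s < f y} * indicator {0..} s \<partial>lborel)"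
    if sf: "sigma_finite_measure M" and f[measurable]: "f \<in> borel_measurable M" for M :: "'x measure" and f
  proof -
    interpret M: sigma_finite_measure M by (rule sf)
    interpret P: pair_sigma_finite M lborel ..
    \<comment> \<open>The interval [0, a) has length a, also for a = \<infinity>; this writes
      \<open>f y\<close> as an integral over s.\<close>
    have len: "(\<integral>\<^sup>+s. (if 0 \<le> s \<and> ennreal s < a then 1 else 0) \<partial>lborel) = a" for a
    proof -
      have "(\<integral>\<^sup>+s. (if 0 \<le> s \<and> ennreal s < a then 1 else 0) \<partial>lborel) =
          (\<integral>\<^sup>+s. indicator {s. 0 \<le> s \<and> ennreal s < a} s \<partial>lborel)"
        by (intro nn_integral_cong) (auto simp: indicator_def)
      also have "\<dots> = emeasure lborel {s. 0 \<le> s \<and> ennreal s < a}"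
        by (intro nn_integral_indicator) measurable
      also have "\<dots> = a"
      proof (cases a)
        case (real r)
        then have "{s. 0 \<le> s \<and> ennreal s < a} = {0..<r}" by (auto simp: ennreal_less_iff)
        then show ?thesis using real by simp
      next
        case top
        then have "{s. 0 \<le> s \<and> ennreal s < a} = {0..}" by auto
        have "of_nat n \<le> emeasure lborel {0::real..}" for n
          using emeasure_mono[of "{0..real n}" "{0..}" lborel] by (simp add: ennreal_of_nat_eq_real_of_nat)
        then have "(SUP n. of_nat n :: ennreal) \<le> emeasure lborel {0::real..}" by (intro SUP_least)
        then show ?thesis using top \<open>_ = {0..}\<close>
          by (simp add: ennreal_SUP_of_nat_eq_top top_unique)
      qed
      finally show ?thesis .
    qed
    have "(\<integral>\<^sup>+y. f y \<partial>M) = (\<integral>\<^sup>+y. (\<integral>\<^sup>+s. (if 0 \<le> s \<and> ennreal s < f y then 1 else 0) \<partial>lborel) \<partial>M)"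
      by (simp add: len)
    also have "\<dots> = (\<integral>\<^sup>+s. (\<integral>\<^sup>+y. (if 0 \<le> s \<and> ennreal s < f y then 1 else 0) \<partial>M) \<partial>lborel)"
      by (intro P.Fubini'[symmetric]) measurable
    also have "\<dots> = (\<integral>\<^sup>+s. emeasure M {y \<in> space M. ennreal s < f y} * indicator {0..} s \<partial>lborel)"
    proof (intro nn_integral_cong)
      fix s :: real
      have "(\<integral>\<^sup>+y. (if 0 \<le> s \<and> ennreal s < f y then 1 else 0) \<partial>M) =
        (\<integral>\<^sup>+y. indicator {y \<in> space M. ennreal s < f y} y * indicator {0..} s \<partial>M)"
        by (intro nn_integral_cong) (auto simp: indicator_def)
      then show "(\<integral>\<^sup>+y. (if 0 \<le> s \<and> ennreal s < f y then 1 else 0) \<partial>M) =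
        emeasure M {y \<in> space M. ennreal s < f y} * indicator {0..} s"
        by (simp add: nn_integral_multc)
    qed
    finally show ?thesis .
  qed
  show ?thesis
    unfolding layer[OF sf(1) f] layer[OF sf(2) h]
    by (intro nn_integral_mono) (auto simp: indicator_def le)
qed

section \<open>The nonlinearity g, the function F and its inverse\<close>

lemma one_divide_antimono_ennreal:
  fixes v w :: ennreal
  assumes "v \<le> w"
  shows "1 / w \<le> 1 / v"
proof (cases "v = 0")
  case False
  then show ?thesis using assms
    by (cases v; cases w) (auto simp: divide_ennreal_def inverse_ennreal top_unique intro!: ennreal_leI)
qed (simp add: divide_ennreal_def)

lemma admissible_nonlinearity_pos_finite:
  assumes "admissible_nonlinearity g" and "1 \<le> t" and "t < \<infinity>"
  shows "0 < g t" "g t < \<infinity>"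
  using assms unfolding admissible_nonlinearity_def by blast+

text \<open>Passes from the real integrand of \<open>F\<close> to the extended one. At finite s the
  value of g is strictly between 0 and \<infinity>, so neither \<open>enn2real\<close> nor the
  division falls back on a default value.\<close>

lemma reciprocal_nonlinearity_eq:
  assumes g: "admissible_nonlinearity g" and s: "1 \<le> s"
  shows "ennreal (1 / enn2real (g (ennreal s))) = 1 / g (ennreal s)"
proof -
  have "0 < g (ennreal s)" "g (ennreal s) < \<infinity>"
    using admissible_nonlinearity_pos_finite[OF g, of "ennreal s"] s by auto
  then obtain r where "g (ennreal s) = ennreal r" "0 < r"
    by (cases "g (ennreal s)") auto
  then show ?thesis by (simp add: divide_ennreal[symmetric])
qed

lemma reciprocal_nonlinearity_pos:
  assumes g: "admissible_nonlinearity g" and s: "1 \<le> s"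
  shows "0 < 1 / enn2real (g (ennreal s))"
  using admissible_nonlinearity_pos_finite[OF g, of "ennreal s"] s by (simp add: enn2real_positive_iff)

lemma reciprocal_nonlinearity_antimono:
  assumes g: "admissible_nonlinearity g" and s: "1 \<le> s" "s \<le> t"
  shows "1 / enn2real (g (ennreal t)) \<le> 1 / enn2real (g (ennreal s))"
proof -
  have "g (ennreal s) \<le> g (ennreal t)"
    using g s unfolding admissible_nonlinearity_def by (auto intro!: mono_onD[of "{1..}" g] ennreal_leI)
  then have "enn2real (g (ennreal s)) \<le> enn2real (g (ennreal t))"
    using admissible_nonlinearity_pos_finite[OF g, of "ennreal t"] s by (intro enn2real_mono) auto
  then show ?thesis
    using reciprocal_nonlinearity_pos[OF g, of s] s by (intro divide_left_mono) auto
qed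

lemma continuous_on_reciprocal_nonlinearity:
  assumes g: "admissible_nonlinearity g"
  shows "continuous_on {1..} (\<lambda>s. 1 / enn2real (g (ennreal s)))"
proof -
  have "continuous_on {1..} g" using g unfolding admissible_nonlinearity_def by blast
  then have "continuous_on {1..} (\<lambda>s::real. g (ennreal s))"
    by (rule continuous_on_compose2) (auto intro: continuous_on_ennreal)
  then have "continuous_on {1..} (\<lambda>s. enn2real (g (ennreal s)))"
    unfolding continuous_on_def
  proof (intro ballI tendsto_enn2real)
    fix s :: real assume s: "s \<in> {1..}" and lim: "\<forall>x\<in>{1..}. ((\<lambda>s. g (ennreal s)) \<longlongrightarrow> g (ennreal x)) (at x within {1..})"
    then show "((\<lambda>s. g (ennreal s)) \<longlongrightarrow> ennreal (enn2real (g (ennreal s)))) (at s within {1..})"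
      using admissible_nonlinearity_pos_finite[OF g, of "ennreal s"] by (simp add: ennreal_enn2real)
  qed auto
  then show ?thesis
    using reciprocal_nonlinearity_pos[OF g] by (intro continuous_intros) force+
qed

text \<open>Nothing is known about g below 1; the shift keeps its argument where it is
  continuous.\<close>

lemma borel_measurable_shifted_nonlinearity:
  assumes g: "admissible_nonlinearity g"
  shows "(\<lambda>v. g (1 + v)) \<in> borel_measurable borel"
proof -
  have "continuous_on {1..} g" using g unfolding admissible_nonlinearity_def by blast
  then have "continuous_on UNIV (\<lambda>v. g (1 + v))"
    by (rule continuous_on_compose2) (auto intro!: continuous_on_add)
  then show ?thesis by (rule borel_measurable_continuous_onI)
qed

lemma F_integrable:
  assumes g: "admissible_nonlinearity g" and a: "1 \<le> a"
  shows "(\<lambda>s. 1 / enn2real (g (ennreal s))) integrable_on {a..t}"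
  using continuous_on_subset[OF continuous_on_reciprocal_nonlinearity[OF g]] a
  by (intro integrable_continuous_real) auto

lemma F_eq_nn_integral:
  assumes g: "admissible_nonlinearity g"
  shows "ennreal (F g t) = (\<integral>\<^sup>+ s. 1 / g (ennreal s) * indicator {1..t} s \<partial>lborel)"
proof -
  let ?r = "\<lambda>s. 1 / enn2real (g (ennreal s))"
  have si: "set_integrable lborel {1..t} ?r"
    using continuous_on_subset[OF continuous_on_reciprocal_nonlinearity[OF g]]
    by (intro borel_integrable_atLeastAtMost') auto
  have "(\<integral>\<^sup>+ s. 1 / g (ennreal s) * indicator {1..t} s \<partial>lborel) =
      (\<integral>\<^sup>+ s. ennreal (indicator {1..t} s *\<^sub>R ?r s) \<partial>lborel)"
    by (intro nn_integral_cong) (auto simp: indicator_def reciprocal_nonlinearity_eq[OF g])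
  also have "\<dots> = ennreal (LINT s:{1..t}|lborel. ?r s)"
    using si unfolding set_lebesgue_integral_def set_integrable_def
    by (intro nn_integral_eq_integral) (auto simp: indicator_def)
  also have "(LINT s:{1..t}|lborel. ?r s) = F g t"
    unfolding F_def by (rule set_borel_integral_eq_integral(2)[OF si])
  finally show ?thesis by simp
qed

text \<open>Valid for arbitrary g and t: the integrand is nonnegative, and without integrability the
  integral is 0 by convention.\<close>

lemma F_nonneg: "0 \<le> F g t"
  unfolding F_def
  by (cases "(\<lambda>s. 1 / enn2real (g (ennreal s))) integrable_on {1..t}")
    (auto intro: integral_nonneg simp: not_integrable_integral)

lemma F_strict_mono:
  assumes g: "admissible_nonlinearity g" and st: "1 \<le> s" "s < t"
  shows "F g s < F g t"
proof -
  let ?r = "\<lambda>s. 1 / enn2real (g (ennreal s))"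
  \<comment> \<open>The decreasing integrand is bounded below on [s, t] by its positive value at
    t.\<close>
  have "0 < ?r t * (t - s)" using reciprocal_nonlinearity_pos[OF g, of t] st by simp
  also have "\<dots> = integral {s..t} (\<lambda>_. ?r t)" using st by simp
  also have "\<dots> \<le> integral {s..t} ?r"
    using st by (intro integral_le F_integrable[OF g] reciprocal_nonlinearity_antimono[OF g]) auto
  also have "\<dots> = F g t - F g s"
    using Henstock_Kurzweil_Integration.integral_combine[of 1 s t ?r] F_integrable[OF g] st by (simp add: F_def)
  finally show ?thesis by simp
qed

lemma F_mono:
  assumes g: "admissible_nonlinearity g" and "1 \<le> s" "s \<le> t"
  shows "F g s \<le> F g t"
  using F_strict_mono[OF g, of s t] assms by (cases "s = t") auto

text \<open>Monotone convergence along [1, n] identifies the integral as the supremum of F at the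
  integers, and monotonicity turns this into the limit. It is never attained, because F(t) < F(t +
  1).\<close>

lemma F_at_infinity_eq:
  assumes g: "admissible_nonlinearity g"
  shows "F_at_infinity g = (\<integral>\<^sup>+ s. 1 / g (ennreal s) * indicator {1..} s \<partial>lborel)" (is "_ = ?I")
    and "1 \<le> t \<Longrightarrow> ennreal (F g t) < F_at_infinity g"
proof -
  have le: "ennreal (F g t) \<le> ?I" for t
    unfolding F_eq_nn_integral[OF g] by (intro nn_integral_mono) (auto simp: indicator_def)
  have "(\<lambda>s. 1 / g (ennreal s) * indicator {1..} s) \<in> borel_measurable borel"
  proof -
    have "(\<lambda>s. ennreal (indicator {1..} s *\<^sub>R (1 / enn2real (g (ennreal s))))) \<in> borel_measurable borel"
      using continuous_on_reciprocal_nonlinearity[OF g]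
      by (intro measurable_compose[OF _ measurable_ennreal] borel_measurable_continuous_on_indicator) auto
    also have "(\<lambda>s. ennreal (indicator {1..} s *\<^sub>R (1 / enn2real (g (ennreal s))))) =
        (\<lambda>s. 1 / g (ennreal s) * indicator {1..} s)"
      by (auto simp: indicator_def reciprocal_nonlinearity_eq[OF g])
    finally show ?thesis .
  qed
  then have "?I = (SUP n. \<integral>\<^sup>+ s. 1 / g (ennreal s) * indicator {1..} s * indicator {1..real n} s \<partial>lborel)"
    by (intro nn_integral_incseq_SUP) (auto simp: incseq_def indicator_eq_0_iff intro!: AE_I2 real_arch_simple)
  also have "\<dots> = (SUP n. ennreal (F g (real n)))"
    unfolding F_eq_nn_integral[OF g]
    by (intro SUP_cong refl nn_integral_cong) (auto simp: indicator_def)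
  finally have I: "?I = (SUP n. ennreal (F g (real n)))" .
  have "((\<lambda>t. ennreal (F g t)) \<longlongrightarrow> ?I) at_top"
  proof (rule increasing_tendsto)
    fix a assume "a < ?I"
    then obtain n where n: "a < ennreal (F g (real n))" unfolding I by (auto simp: less_SUP_iff)
    have "a < ennreal (F g t)" if "max 1 (real n) \<le> t" for t
    proof (rule less_le_trans[OF n])
      show "ennreal (F g (real n)) \<le> ennreal (F g t)"
        unfolding F_eq_nn_integral[OF g] using that
        by (intro nn_integral_mono) (auto simp: indicator_def)
    qed
    then show "\<forall>\<^sub>F t in at_top. a < ennreal (F g t)"
      unfolding eventually_at_top_linorder by blast
  qed (simp add: le)
  then show eq: "F_at_infinity g = ?I"
    unfolding F_at_infinity_def by (intro tendsto_Lim) auto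
  assume "1 \<le> t"
  then have "ennreal (F g t) < ennreal (F g (t + 1))"
    using F_strict_mono[OF g, of t "t + 1"] by (simp add: ennreal_less_iff F_nonneg)
  also have "\<dots> \<le> F_at_infinity g" unfolding eq by (rule le)
  finally show "ennreal (F g t) < F_at_infinity g" .
qed

text \<open>The intermediate value theorem finds a preimage of p already in [1, t]; since F is
  injective, \<open>inv_into\<close> must choose that one.\<close>

lemma F_inverse_le:
  assumes g: "admissible_nonlinearity g" and t: "1 \<le> t" and p: "0 \<le> p" "p \<le> F g t"
  shows "F_inverse g p \<le> t"
proof -
  have "continuous_on {1..t} (F g)"
    unfolding F_def by (intro indefinite_integral_continuous_1 F_integrable[OF g]) simp
  moreover have "F g 1 = 0" by (simp add: F_def)
  ultimately obtain s where s: "1 \<le> s" "s \<le> t" "F g s = p"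
    using IVT'[of "F g" 1 p t] t p by auto
  have "inj_on (F g) {1..}"
    using F_strict_mono[OF g] by (intro strict_mono_on_imp_inj_on strict_mono_onI) auto
  then have "F_inverse g p = s"
    unfolding F_inverse_def using s by (intro inv_into_f_eq) auto
  then show ?thesis using s by simp
qed

section \<open>The estimate by b times Lebesgue measure\<close>

lemma nn_integral_shifted_reciprocal:
  assumes g: "admissible_nonlinearity g" and m: "0 \<le> m" and b: "0 < b"
  shows "(\<integral>\<^sup>+ t. 1 / g (1 + ennreal t) \<partial>density lborel (\<lambda>t. ennreal b * indicator {0..m / b} t)) =
    ennreal (b * F g (1 + m / b))"
proof -
  note gm[measurable] = borel_measurable_shifted_nonlinearity[OF g]
  have [measurable]: "(\<lambda>t. g (1 + ennreal t)) \<in> borel_measurable borel"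
    by (rule measurable_compose[OF measurable_ennreal gm])
  have "(\<integral>\<^sup>+ t. 1 / g (1 + ennreal t) \<partial>density lborel (\<lambda>t. ennreal b * indicator {0..m / b} t)) =
      (\<integral>\<^sup>+ t. ennreal b * (1 / g (1 + ennreal t) * indicator {0..m / b} t) \<partial>lborel)"
    by (subst nn_integral_density) (auto intro!: nn_integral_cong simp: ac_simps)
  also have "\<dots> = ennreal b * (\<integral>\<^sup>+ t. 1 / g (1 + ennreal t) * indicator {0..m / b} t \<partial>lborel)"
    by (intro nn_integral_cmult) auto
  also have "(\<integral>\<^sup>+ t. 1 / g (1 + ennreal t) * indicator {0..m / b} t \<partial>lborel) =
      (\<integral>\<^sup>+ s. 1 / g (1 + ennreal (s - 1)) * indicator {0..m / b} (s - 1) \<partial>lborel)"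
    by (subst nn_integral_real_affine[where c = 1 and t = "-1"]) auto
  also have "\<dots> = (\<integral>\<^sup>+ s. 1 / g (ennreal s) * indicator {1..1 + m / b} s \<partial>lborel)"
  proof (intro nn_integral_cong)
    fix s :: real
    show "1 / g (1 + ennreal (s - 1)) * indicator {0..m / b} (s - 1) =
        1 / g (ennreal s) * indicator {1..1 + m / b} s"
    proof (cases "1 \<le> s")
      case True
      then have "1 + ennreal (s - 1) = ennreal s"
        by (simp add: ennreal_plus[symmetric] del: ennreal_plus flip: ennreal_1)
      then show ?thesis by (auto simp: indicator_def)
    qed (auto simp: indicator_def)
  qed
  also have "\<dots> = ennreal (F g (1 + m / b))" by (rule F_eq_nn_integral[OF g, symmetric])
  finally show ?thesis using b by (simp add: ennreal_mult F_nonneg)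
qed

text \<open>Both \<rho> and \<tau> have mass m, and \<rho> gives to the set V \<le> t at most b t,
  which is what \<tau> gives to [0, t] for t \<le> m/b. So V under \<rho> lies further to the right
  than the identity under \<tau>, and the decreasing \<psi> reverses this: its superlevel sets are
  initial segments, for which the \<tau>-measure is the larger one.\<close>

lemma nn_integral_reciprocal_potential_le:
  fixes \<sigma> :: "'a::t2_space measure"
  assumes \<sigma>: "radon_measure \<sigma>" and G: "lsc G" and wmp: "weak_maximum_principle G b" and b: "0 < b"
    and g: "admissible_nonlinearity g"
    and k[measurable]: "k \<in> borel_measurable borel" and K: "compact K"
    and bound: "\<And>y. k y \<le> ennreal c * indicator K y"
    and m: "potential G (density \<sigma> k) x = ennreal m" "0 \<le> m"
  shows "(\<integral>\<^sup>+y. 1 / g (1 + potential G (density \<sigma> k) y) \<partial>density (density \<sigma> k) (\<lambda>y. G (x, y)))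
    \<le> ennreal (b * F g (1 + m / b))"
proof -
  define V where "V = potential G (density \<sigma> k)"
  define \<psi> where "\<psi> v = 1 / g (1 + v)" for v
  define \<rho> where "\<rho> = density (density \<sigma> k) (\<lambda>y. G (x, y))"
  define \<tau> where "\<tau> = density lborel (\<lambda>t. ennreal b * indicator {0..m / b} t)"
  have sets[measurable_cong]: "sets \<sigma> = sets borel" by (rule radon_measure_sets[OF \<sigma>])
  have sets_\<rho>[measurable_cong]: "sets \<rho> = sets borel" by (simp add: \<rho>_def sets)
  have sp: "space \<rho> = UNIV" using sets_eq_imp_space_eq[OF sets_\<rho>] by simp
  have G_meas[measurable]: "(\<lambda>y. G (z, y)) \<in> borel_measurable borel" for z
    by (rule borel_measurable_lsc[OF lsc_section[OF G]])
  have "lsc V" unfolding V_def using radon_measure_density[OF \<sigma> k K bound] G by (intro lsc_potential)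
  then have V[measurable]: "V \<in> borel_measurable borel" by (rule borel_measurable_lsc)
  note borel_measurable_shifted_nonlinearity[OF g, measurable]
  have [measurable]: "\<psi> \<in> borel_measurable borel" unfolding \<psi>_def by measurable
  have \<psi>_mono: "\<psi> w \<le> \<psi> v" if "v \<le> w" for v w
  proof -
    have "g (1 + v) \<le> g (1 + w)"
      using g that unfolding admissible_nonlinearity_def
      by (auto intro!: mono_onD[of "{1..}" g] add_left_mono)
    then show ?thesis unfolding \<psi>_def by (rule one_divide_antimono_ennreal)
  qed
  have emeasure_\<rho>: "emeasure \<rho> A = (\<integral>\<^sup>+y. G (x, y) * indicator A y \<partial>density \<sigma> k)"
    if "A \<in> sets borel" for A
    using that sets unfolding \<rho>_def by (intro emeasure_density) auto
  have total: "emeasure \<rho> UNIV = ennreal m"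
    using m(1) by (simp add: emeasure_\<rho> potential_def)
  have \<tau>_Icc: "emeasure \<tau> {0..m / b} = ennreal m"
    using b m(2) unfolding \<tau>_def
    by (subst emeasure_density) (auto simp: nn_integral_cmult_indicator mult.assoc indicator_inter_arith[symmetric] ennreal_mult[symmetric])
  have fin: "finite_measure \<rho>" "finite_measure \<tau>"
  proof -
    show "finite_measure \<rho>" using total sp by (intro finite_measureI) simp
    have "emeasure \<tau> UNIV = ennreal m"
      using b m(2) unfolding \<tau>_def
      by (subst emeasure_density) (auto simp: nn_integral_cmult_indicator ennreal_mult[symmetric])
    then show "finite_measure \<tau>" by (intro finite_measureI) (simp add: \<tau>_def)
  qed
  have "(\<integral>\<^sup>+y. \<psi> (V y) \<partial>\<rho>) \<le> (\<integral>\<^sup>+t. \<psi> (ennreal t) \<partial>\<tau>)"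
  proof (rule nn_integral_mono_distribution)
    show "sigma_finite_measure \<rho>" "sigma_finite_measure \<tau>"
      using fin by (simp_all add: finite_measure_def)
    show "(\<lambda>y. \<psi> (V y)) \<in> borel_measurable \<rho>" by measurable
    show "(\<lambda>t. \<psi> (ennreal t)) \<in> borel_measurable \<tau>" unfolding \<tau>_def by measurable
    fix s :: real
    let ?S = "{y \<in> space \<rho>. ennreal s < \<psi> (V y)}" and ?T = "{t \<in> space \<tau>. ennreal s < \<psi> (ennreal t)}"
    have S[measurable]: "?S \<in> sets \<rho>" by measurable
    have T: "?T \<in> sets \<tau>" unfolding \<tau>_def by measurable
    have spt: "space \<tau> = UNIV" by (simp add: \<tau>_def)
    show "emeasure \<rho> ?S \<le> emeasure \<tau> ?T"
    \<comment> \<open>In the first case \<open>?T\<close> contains all of [0, m/b], so equality of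
      the total masses suffices. Otherwise the initial segment A ends at some \<theta> \<le> m/b and
      the level set bound is used.\<close>
    proof (cases "ennreal s < \<psi> (ennreal (m / b))")
      case True
      have "emeasure \<rho> ?S \<le> emeasure \<rho> UNIV" using sets_\<rho> by (intro emeasure_mono) auto
      also have "\<dots> = emeasure \<tau> {0..m / b}" by (simp add: total \<tau>_Icc)
      also have "\<dots> \<le> emeasure \<tau> ?T"
        using less_le_trans[OF True \<psi>_mono] T spt by (intro emeasure_mono) (auto simp: ennreal_leI)
      finally show ?thesis .
    next
      case False
      define A where "A = {t. 0 \<le> t \<and> ennreal s < \<psi> (ennreal t)}"
      have down: "t \<in> A" if "r \<in> A" "0 \<le> t" "t \<le> r" for t r
        using that less_le_trans[of "ennreal s" "\<psi> (ennreal r)" "\<psi> (ennreal t)"] \<psi>_mono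
        by (auto simp: A_def ennreal_leI)
      have A_less: "t < m / b" if "t \<in> A" for t
        using that False down[of t "m / b"] b m(2) by (force simp: A_def)
      \<comment> \<open>The supremum of the empty set of reals carries no information, hence the
        separate value 0.\<close>
      define \<theta> where "\<theta> = (if A = {} then 0 else Sup A)"
      have bdd: "bdd_above A" using A_less by (intro bdd_aboveI[of _ "m / b"]) (auto intro: less_imp_le)
      have \<theta>_above: "t \<notin> A" if "\<theta> < t" for t
        using that cSup_upper[OF _ bdd, of t] by (auto simp: \<theta>_def split: if_splits)
      have \<theta>_below: "t \<in> A" if "0 \<le> t" "t < \<theta>" for t
        using that less_cSup_iff[OF _ bdd, of t] down by (auto simp: \<theta>_def less_imp_le split: if_splits)
      have \<theta>_nonneg: "0 \<le> \<theta>"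
      proof (cases "A = {}")
        case False
        then obtain a where "a \<in> A" by blast
        then show ?thesis using cSup_upper[OF _ bdd, of a] by (auto simp: \<theta>_def A_def)
      qed (simp add: \<theta>_def)
      have \<theta>_le: "\<theta> \<le> m / b"
      proof (cases "A = {}")
        case False
        then have "Sup A \<le> m / b" using A_less by (intro cSup_least less_imp_le)
        then show ?thesis using False by (simp add: \<theta>_def)
      qed (use b m(2) in \<open>simp add: \<theta>_def\<close>)
      \<comment> \<open>Whether \<theta> belongs to A is left open, and the level set bound requires
        a positive level. Hence levels t > \<theta> are used, and afterwards t tends to
        \<theta>.\<close>
      have upper: "emeasure \<rho> ?S \<le> ennreal (b * t)" if t: "\<theta> < t" for t
      proof -
        have "V y \<le> ennreal t" if "y \<in> ?S" for y
        proof (rule ccontr)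
          assume "\<not> V y \<le> ennreal t"
          then have "\<psi> (V y) \<le> \<psi> (ennreal t)" by (intro \<psi>_mono) simp
          then show False using that \<theta>_above[OF t] t \<theta>_nonneg by (auto simp: A_def)
        qed
        then have "emeasure \<rho> ?S \<le> emeasure \<rho> {y. V y \<le> ennreal t}"
          by (intro emeasure_mono) auto
        also have "\<dots> = (\<integral>\<^sup>+y. G (x, y) * indicator {y. V y \<le> ennreal t} y \<partial>density \<sigma> k)"
          by (intro emeasure_\<rho>) measurable
        also have "\<dots> \<le> ennreal (b * t)"
          unfolding V_def using t \<theta>_nonneg b
          by (intro potential_level_set_bound[OF \<sigma> G wmp _ k K bound]) auto
        finally show ?thesis .
      qed
      have "emeasure \<rho> ?S \<le> ennreal (b * \<theta>)"
      proof (rule ennreal_le_epsilon)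
        fix e :: real assume e: "0 < e"
        \<comment> \<open>The excess e/b over \<theta> costs exactly e.\<close>
        have "emeasure \<rho> ?S \<le> ennreal (b * (\<theta> + e / b))" using e b by (intro upper) simp
        also have "b * (\<theta> + e / b) = b * \<theta> + e" using b by (simp add: field_simps)
        finally show "emeasure \<rho> ?S \<le> ennreal (b * \<theta>) + ennreal e"
          using e b \<theta>_nonneg by (simp add: ennreal_plus)
      qed
      also have "\<dots> = (\<integral>\<^sup>+t. ennreal b * indicator {0..<\<theta>} t \<partial>lborel)"
        using b \<theta>_nonneg by (simp add: nn_integral_cmult_indicator ennreal_mult)
      also have "\<dots> \<le> (\<integral>\<^sup>+t. ennreal b * indicator {0..m / b} t * indicator ?T t \<partial>lborel)"
        using \<theta>_below \<theta>_le spt by (intro nn_integral_mono) (auto simp: indicator_def A_def)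
      also have "\<dots> = emeasure \<tau> ?T"
        using T unfolding \<tau>_def by (intro emeasure_density[symmetric]) auto
      finally show ?thesis .
    qed
  qed
  also have "(\<integral>\<^sup>+t. \<psi> (ennreal t) \<partial>\<tau>) = ennreal (b * F g (1 + m / b))"
    unfolding \<psi>_def \<tau>_def by (rule nn_integral_shifted_reciprocal[OF g m(2) b])
  finally show ?thesis by (simp add: \<psi>_def V_def \<rho>_def)
qed

section \<open>Estimate on compact sets, exhaustion and conclusion\<close>

theorem theorem1p1:
  fixes \<sigma> :: "'a::t2_space measure"
    and G :: "'a \<times> 'a \<Rightarrow> ennreal"
    and b :: real
    and g :: "ennreal \<Rightarrow> ennreal"
    and u :: "'a \<Rightarrow> ennreal"
    and x :: 'a
  assumes "locally_compact_space (euclidean :: 'a topology)"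
    and "radon_measure \<sigma>"
    and "lsc G"
    and "b \<ge> 1"
    and "weak_maximum_principle G b"
    and "admissible_nonlinearity g"
    and "u \<in> borel_measurable \<sigma>"
    and "\<forall>y. 0 < u y"
    and "AE y in \<sigma>. u y \<ge> weighted_potential G (\<lambda>z. g (u z)) \<sigma> y + 1"
    and "u x \<ge> weighted_potential G (\<lambda>z. g (u z)) \<sigma> x + 1"
    and "u x < \<infinity>"
  shows "potential G \<sigma> x < ennreal b * F_at_infinity g
       \<and> ennreal b * F_at_infinity g
           = ennreal b * (\<integral>\<^sup>+ s. 1 / g (ennreal s) * indicator {1..} s \<partial>lborel)
       \<and> u x \<ge> ennreal (1 + b * (F_inverse g (enn2real (potential G \<sigma> x) / b) - 1))"
proof -
  note \<sigma> = assms(2) and G = assms(3) and wmp = assms(5) and g = assms(6) and ux = assms(10,11)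
  have b: "0 < b" using assms(4) by simp
  have sets[measurable_cong]: "sets \<sigma> = sets borel" by (rule radon_measure_sets[OF \<sigma>])
  have G_meas[measurable]: "(\<lambda>y. G (z, y)) \<in> borel_measurable borel" for z
    by (rule borel_measurable_lsc[OF lsc_section[OF G]])
  have g_mono: "g s \<le> g t" if "1 \<le> s" "s \<le> t" for s t
    using g that unfolding admissible_nonlinearity_def by (auto intro!: mono_onD[of "{1..}" g])
  \<comment> \<open>Truncating at 1 keeps the argument of g in its domain, so f is measurable
    everywhere; it equals g(u) almost everywhere because the inequality for u forces u \<ge>
    1.\<close>
  define f where "f y = g (max 1 (u y))" for y
  have "continuous_on {1..} g" using g unfolding admissible_nonlinearity_def by blast
  then have "continuous_on UNIV (\<lambda>v. g (max 1 v))"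
    by (rule continuous_on_compose2) (auto intro!: continuous_on_max continuous_intros)
  from borel_measurable_continuous_onI[OF this] assms(7)
  have f_\<sigma>: "f \<in> borel_measurable \<sigma>"
    unfolding f_def by (rule measurable_compose[rotated])
  then have f[measurable]: "f \<in> borel_measurable borel" by (simp add: measurable_cong_sets[OF sets refl])
  have AE_f: "AE y in \<sigma>. f y = g (u y)"
    using assms(9)
  proof eventually_elim
    case (elim y)
    have "1 \<le> weighted_potential G (\<lambda>z. g (u z)) \<sigma> y + 1" by simp
    then have "1 \<le> u y" using elim by (rule order_trans)
    then show ?case by (simp add: f_def max_absorb2)
  qed
  define w where "w z = (\<integral>\<^sup>+y. G (z, y) * f y \<partial>\<sigma>)" for z
  have w: "weighted_potential G (\<lambda>z. g (u z)) \<sigma> z = w z" for z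
    unfolding weighted_potential_def w_def using AE_f
    by (intro nn_integral_cong_AE) (auto elim!: eventually_mono)
  have AE_u: "AE y in \<sigma>. w y + 1 \<le> u y" using assms(9) by (simp add: w)
  obtain M where M: "u x = ennreal (1 + M)" "0 \<le> M" "w x \<le> ennreal M"
  proof -
    obtain r where r: "u x = ennreal r" "0 \<le> r" using ux(2) by (cases "u x") auto
    have le: "w x + 1 \<le> ennreal r" using ux(1) r by (simp add: w)
    then obtain q where q: "w x = ennreal q" "0 \<le> q" by (cases "w x") (auto simp: top_unique)
    then have "q + 1 \<le> r" using le r by (simp flip: ennreal_1 ennreal_plus)
    then show ?thesis using that[of "r - 1"] q r by (auto intro: ennreal_leI)
  qed
  \<comment> \<open>M is u(x) - 1, so the target bound B is b F(1 + (u(x) - 1)/b).\<close>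
  define T where "T = 1 + M / b"
  define B where "B = ennreal (b * F g T)"
  have T: "1 \<le> T" using M b by (simp add: T_def)
  have compact_bound: "(\<integral>\<^sup>+y. G (x, y) * indicator K y \<partial>\<sigma>) \<le> B"
    if K: "compact K" and fc: "\<And>y. y \<in> K \<Longrightarrow> f y \<le> ennreal c" for K c
  proof -
    have Kb[measurable]: "K \<in> sets borel" using K by (simp add: compact_imp_closed)
    define k where "k y = f y * indicator K y" for y
    have k[measurable]: "k \<in> borel_measurable borel" unfolding k_def by measurable
    have kc: "k y \<le> ennreal c * indicator K y" for y using fc by (auto simp: k_def indicator_def)
    define V where "V = potential G (density \<sigma> k)"
    have V_le: "V z \<le> w z" for z
    proof -
      have "V z = (\<integral>\<^sup>+y. k y * G (z, y) \<partial>\<sigma>)"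
        unfolding V_def potential_def by (intro nn_integral_density) auto
      also have "\<dots> \<le> w z"
        unfolding w_def by (intro nn_integral_mono) (auto simp: k_def indicator_def mult.commute)
      finally show ?thesis .
    qed
    obtain m where m: "V x = ennreal m" "0 \<le> m" "m \<le> M"
      using order_trans[OF V_le M(3)] M(2) by (cases "V x") (auto simp: top_unique)
    have "lsc V" unfolding V_def using radon_measure_density[OF \<sigma> k K kc] G by (intro lsc_potential)
    then have V[measurable]: "V \<in> borel_measurable borel" by (rule borel_measurable_lsc)
    have [measurable]: "(\<lambda>y. g (1 + V y)) \<in> borel_measurable borel"
      by (rule measurable_compose[OF V borel_measurable_shifted_nonlinearity[OF g]])
    \<comment> \<open>Since k \<le> f, almost everywhere 1 + V \<le> 1 + w \<le> u, hence g(1 + V)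
      \<le> f. With 0 < f < \<infinity> on K this says f / g(1 + V) \<ge> 1, and that factor is
      inserted into the integral.\<close>
    have "AE y in \<sigma>. G (x, y) * indicator K y \<le> k y * (G (x, y) * (1 / g (1 + V y)))"
      using AE_u AE_f
    proof eventually_elim
      case (elim y)
      show ?case
      proof (cases "y \<in> K")
        case True
        have "1 + V y \<le> w y + 1" unfolding add.commute[of 1] by (intro add_right_mono V_le)
        then have "1 + V y \<le> u y" using elim(1) by (rule order_trans)
        then have "g (1 + V y) \<le> f y" unfolding elim(2) by (intro g_mono) auto
        then have "f y * (1 / f y) \<le> f y * (1 / g (1 + V y))"
          by (intro mult_left_mono one_divide_antimono_ennreal) auto
        moreover have "0 < f y"
        proof -
          have "\<forall>t\<ge>1. 0 < g t" using g unfolding admissible_nonlinearity_def by blast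
          then show ?thesis by (simp add: f_def)
        qed
        moreover have "f y \<noteq> top" using fc[OF True] by (auto simp: top_unique)
        ultimately have "1 \<le> f y * (1 / g (1 + V y))"
          by (simp add: ennreal_times_divide less_top[symmetric] zero_less_iff_neq_zero)
        then have "G (x, y) * 1 \<le> G (x, y) * (f y * (1 / g (1 + V y)))" by (intro mult_left_mono) auto
        then show ?thesis using True by (simp add: k_def ac_simps)
      qed simp
    qed
    then have "(\<integral>\<^sup>+y. G (x, y) * indicator K y \<partial>\<sigma>) \<le> (\<integral>\<^sup>+y. k y * (G (x, y) * (1 / g (1 + V y))) \<partial>\<sigma>)"
      by (rule nn_integral_mono_AE)
    also have "\<dots> = (\<integral>\<^sup>+y. G (x, y) * (1 / g (1 + V y)) \<partial>density \<sigma> k)"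
      by (intro nn_integral_density[symmetric]) auto
    also have "\<dots> = (\<integral>\<^sup>+y. 1 / g (1 + V y) \<partial>density (density \<sigma> k) (\<lambda>y. G (x, y)))"
      by (intro nn_integral_density[symmetric]) auto
    also have "\<dots> \<le> ennreal (b * F g (1 + m / b))"
      unfolding V_def
      by (rule nn_integral_reciprocal_potential_le[OF \<sigma> G wmp b g k K kc m(1)[unfolded V_def] m(2)])
    also have "\<dots> \<le> B"
      unfolding B_def T_def using m b
      by (intro ennreal_leI mult_left_mono F_mono[OF g] add_left_mono divide_right_mono) auto
    finally show ?thesis .
  qed
  have G_fin: "(\<integral>\<^sup>+y. G (x, y) \<partial>\<sigma>) < \<infinity>"
  proof -
    have g1: "0 < g 1" "g 1 < \<infinity>" using admissible_nonlinearity_pos_finite[OF g, of 1] by auto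
    have "(\<integral>\<^sup>+y. G (x, y) \<partial>\<sigma>) * g 1 = (\<integral>\<^sup>+y. G (x, y) * g 1 \<partial>\<sigma>)"
      by (intro nn_integral_multc[symmetric]) auto
    also have "\<dots> \<le> w x"
      unfolding w_def f_def by (intro nn_integral_mono mult_left_mono g_mono) auto
    also have "\<dots> < \<infinity>" using M(3) by (auto intro: le_less_trans)
    finally show ?thesis using g1 by (auto simp: ennreal_mult_less_top)
  qed
  \<comment> \<open>The first condition gives \<open>D n\<close> finite \<sigma>-measure by Markov's
    inequality for the integrable G(x, \<cdot>), so compact sets exhaust it up to a null set. The
    second bounds f by n, as \<open>compact_bound\<close> requires.\<close>
  define D where "D n = {y. 1 \<le> of_nat n * G (x, y) \<and> f y \<le> of_nat n}" for n :: nat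
  have D[measurable]: "D n \<in> sets borel" for n unfolding D_def by measurable
  have D_mono: "incseq D"
  proof (intro monoI subsetI)
    fix m n y assume "m \<le> n" and y: "y \<in> D m"
    then have "(of_nat m :: ennreal) \<le> of_nat n" by simp
    moreover from this have "of_nat m * G (x, y) \<le> of_nat n * G (x, y)" by (rule mult_right_mono) simp
    ultimately show "y \<in> D n" using y by (auto simp: D_def intro: order_trans)
  qed
  have D_bound: "(\<integral>\<^sup>+y. G (x, y) * indicator (D n) y \<partial>\<sigma>) \<le> B" for n
  proof -
    have "emeasure \<sigma> (D n) \<le> emeasure \<sigma> {y \<in> UNIV. 1 \<le> of_nat n * G (x, y)}"
      unfolding D_def by (intro emeasure_mono) auto
    also have "\<dots> \<le> of_nat n * (\<integral>\<^sup>+y. G (x, y) * indicator UNIV y \<partial>\<sigma>)"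
      using sets by (intro nn_integral_Markov_inequality) auto
    also have "\<dots> < \<infinity>" using G_fin by (simp add: ennreal_mult_less_top ennreal_of_nat_eq_real_of_nat)
    finally obtain L where L: "\<And>i. compact (L i)" "\<And>i::nat. L i \<subseteq> D n" "incseq L"
        "emeasure \<sigma> (D n - (\<Union>i. L i)) = 0"
      using radon_measure_inner_regular[OF \<sigma> D] by metis
    have Lb[measurable]: "L i \<in> sets borel" for i using L by (simp add: compact_imp_closed)
    have "D n - (\<Union>i. L i) \<in> null_sets \<sigma>" using L(4) by (intro null_setsI) auto
    from AE_not_in[OF this]
    have "(\<integral>\<^sup>+y. G (x, y) * indicator (D n) y \<partial>\<sigma>) =
        (SUP i. \<integral>\<^sup>+y. G (x, y) * indicator (D n) y * indicator (L i) y \<partial>\<sigma>)"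
      using L(3) by (intro nn_integral_incseq_SUP) (auto elim!: eventually_mono simp: indicator_eq_0_iff)
    also have "\<dots> \<le> B"
    proof (rule SUP_least)
      fix i
      have "(\<integral>\<^sup>+y. G (x, y) * indicator (D n) y * indicator (L i) y \<partial>\<sigma>) =
          (\<integral>\<^sup>+y. G (x, y) * indicator (L i) y \<partial>\<sigma>)"
        using L(2)[of i] by (intro nn_integral_cong) (auto simp: indicator_def)
      also have "\<dots> \<le> B"
        using L(2)[of i] by (intro compact_bound[OF L(1), of _ "real n"])
          (auto simp: D_def ennreal_of_nat_eq_real_of_nat)
      finally show "(\<integral>\<^sup>+y. G (x, y) * indicator (D n) y * indicator (L i) y \<partial>\<sigma>) \<le> B" .
    qed
    finally show ?thesis .
  qed
  \<comment> \<open>f may be infinite, but as w(x) is finite this happens almost everywhere only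
    where G(x, \<cdot>) vanishes, so the sets \<open>D n\<close> cover all that matters for the
    integral.\<close>
  have "AE y in \<sigma>. G (x, y) * f y \<noteq> \<infinity>"
    using M(3) by (intro nn_integral_PInf_AE) (auto simp: w_def top_unique)
  then have "AE y in \<sigma>. G (x, y) \<noteq> 0 \<longrightarrow> y \<in> (\<Union>n. D n)"
  proof eventually_elim
    case (elim y)
    show ?case
    proof
      assume pos: "G (x, y) \<noteq> 0"
      then have "f y \<noteq> top" using elim by (auto simp: ennreal_mult_top)
      then obtain n1 where n1: "f y \<le> of_nat n1"
        using ennreal_Ex_less_of_nat[of "f y"] by (auto simp: less_top intro: less_imp_le)
      obtain n2 where n2: "1 \<le> of_nat n2 * G (x, y)"
      proof (cases "G (x, y)")
        case (real r)
        then have "0 < r" using pos by (auto simp: less_le)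
        then obtain n :: nat where "1 / r < real n" using reals_Archimedean2 by blast
        then have "1 \<le> real n * r" using \<open>0 < r\<close> by (simp add: field_simps less_imp_le)
        then show ?thesis
          using that[of n] real by (simp add: ennreal_of_nat_eq_real_of_nat ennreal_mult[symmetric])
      next
        case top
        then show ?thesis using that[of 1] by simp
      qed
      have "(1::ennreal) \<le> of_nat (max n1 n2) * G (x, y)"
        using n2 by (rule order_trans) (intro mult_right_mono, auto)
      moreover have "f y \<le> of_nat (max n1 n2)"
        using n1 by (rule order_trans) auto
      ultimately show "y \<in> (\<Union>n. D n)" by (auto simp: D_def)
    qed
  qed
  then have "potential G \<sigma> x = (SUP n. \<integral>\<^sup>+y. G (x, y) * indicator (D n) y \<partial>\<sigma>)"
    unfolding potential_def
    using D_mono by (intro nn_integral_incseq_SUP) auto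
  also have "\<dots> \<le> B" by (intro SUP_least D_bound)
  finally have main: "potential G \<sigma> x \<le> B" .
  show ?thesis
  proof (intro conjI)
    note main
    also have "B < ennreal b * F_at_infinity g"
      unfolding B_def using b F_at_infinity_eq(2)[OF g T]
      by (simp add: ennreal_mult F_nonneg ennreal_mult_strict_left_mono)
    finally show "potential G \<sigma> x < ennreal b * F_at_infinity g" .
    show "ennreal b * F_at_infinity g
        = ennreal b * (\<integral>\<^sup>+ s. 1 / g (ennreal s) * indicator {1..} s \<partial>lborel)"
      by (simp only: F_at_infinity_eq(1)[OF g])
    \<comment> \<open>The potential is finite by \<open>main\<close>, so \<open>enn2real\<close>
      keeps its value. Divided by b it is at most F(T), so its F-preimage is at most T, and b (T -
      1) = M.\<close>
    have "enn2real (potential G \<sigma> x) \<le> b * F g T"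
      using main b unfolding B_def by (intro enn2real_leI) (auto simp: F_nonneg)
    then have "F_inverse g (enn2real (potential G \<sigma> x) / b) \<le> T"
      using b by (intro F_inverse_le[OF g T]) (auto simp: field_simps)
    then have "1 + b * (F_inverse g (enn2real (potential G \<sigma> x) / b) - 1) \<le> 1 + b * (T - 1)"
      using b by simp
    also have "\<dots> = 1 + M" using b by (simp add: T_def)
    finally show "u x \<ge> ennreal (1 + b * (F_inverse g (enn2real (potential G \<sigma> x) / b) - 1))"
      unfolding M(1) by (rule ennreal_leI)
  qed
qed

end
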